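(* Let $(M,p_0)$ be a based metric space that is Lipschitz path connected and has more than one element. Then the first Lipschitz homotopy group $\pi_1^{\mathrm{Lip}}(M,p_0)$ acts freely and isometrically on the universal path space $\mathcal{P}_M$ (with its lifted pseudo-metric $d_{\mathcal{P}}$) via the left action by concatenation, $[\alpha]\ast[\gamma]=[\alpha\ast\gamma]$ for $[\alpha]\in\pi_1^{\mathrm{Lip}}(M,p_0)$ and $[\gamma]\in\mathcal{P}_M$.
   Context: All paths and loops are Lipschitz with domain $I=[0,1]$ (Euclidean metric); $\ell(\gamma)$ is the length of $\gamma$, $\overline{\gamma}$ the inverse path, $*$ concatenation. A metric space is Lipschitz path connected if any two points are joined by a Lipschitz path. $I\times I$ carries the $L^1$ metric. Two paths $\gamma,\gamma'$ in $M$ with the same initial points and the same end points are homotopic rel endpoints, $\gamma\simeq\gamma'$, if there is a Lipschitz map $H:I\times I\to M$ with $H|_{I\times\{0\}}=\gamma$, $H|_{I\times\{1\}}=\gamma'$, $H|_{\{0\}\times I}\equiv\gamma(0)$, $H|_{\{1\}\times I}\equiv\gamma(1)$; $[\gamma]$ denotes the class of $\gamma$. The first Lipschitz homotopy group $\pi_1^{\mathrm{Lip}}(M,p_0)$ is the set of classes of loops based at $p_0$ with group operation given by concatenation. The universal (Lipschitz) path space of $(M,p_0)$ is $\mathcal{P}_M=\{[\gamma] : \gamma:I\to M \text{ Lipschitz},\ \gamma(0)=p_0\}$, with base point $[p_0]$ (the class of the constant loop) and lifted pseudo-metric $d_{\mathcal{P}}([\gamma_1],[\gamma_2])=\inf\{\ell(\beta):\beta\simeq\overline{\gamma_1}*\gamma_2\}$.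 *)

theory Defs
  imports "HOL-Analysis.Analysis" "HOL-Algebra.Group_Action"
begin

text \<open>
  Metric spaces are represented as subsets \<open>M\<close> of a type of class \<open>metric_space\<close>, with the
  induced metric. Paths are functions \<open>real \<Rightarrow> 'a\<close> of which only the values on \<open>{0..1}\<close> matter.
\<close>

definition lip_path :: "'a::metric_space set \<Rightarrow> (real \<Rightarrow> 'a) \<Rightarrow> bool" where
  "lip_path M \<gamma> \<longleftrightarrow> (\<exists>L. L-lipschitz_on {0..1} \<gamma>) \<and> path_image \<gamma> \<subseteq> M"

definition lip_path_connected :: "'a::metric_space set \<Rightarrow> bool" where
  "lip_path_connected M \<longleftrightarrow>
     (\<forall>x\<in>M. \<forall>y\<in>M. \<exists>\<gamma>. lip_path M \<gamma> \<and> pathstart \<gamma> = x \<and> pathfinish \<gamma> = y)"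

text \<open>
  The supremum is taken over all partitions \<open>0 = t 0 \<le> \<dots> \<le> t n = 1\<close>. It is a supremum in the
  reals, so it is meaningful only for rectifiable paths; it is only applied to Lipschitz paths.
\<close>

definition curve_length :: "(real \<Rightarrow> 'a::metric_space) \<Rightarrow> real" where
  "curve_length \<gamma> =
     Sup {(\<Sum>i<n. dist (\<gamma> (t i)) (\<gamma> (t (Suc i)))) | (n::nat) (t::nat \<Rightarrow> real).
            mono_on {..n} t \<and> t 0 = 0 \<and> t n = 1}"

text \<open>
  The Lipschitz condition on the homotopy is written out because \<open>I \<times> I\<close> carries the \<open>L\<^sup>1\<close> metric,
  whereas the library metric on a product type is the Euclidean one.
\<close>

definition lip_homotopic ::
    "'a::metric_space set \<Rightarrow> (real \<Rightarrow> 'a) \<Rightarrow> (real \<Rightarrow> 'a) \<Rightarrow> bool" where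
  "lip_homotopic M \<gamma> \<gamma>' \<longleftrightarrow>
     lip_path M \<gamma> \<and> lip_path M \<gamma>' \<and>
     pathstart \<gamma> = pathstart \<gamma>' \<and> pathfinish \<gamma> = pathfinish \<gamma>' \<and>
     (\<exists>H :: real \<times> real \<Rightarrow> 'a.
        H ` ({0..1} \<times> {0..1}) \<subseteq> M \<and>
        (\<exists>L\<ge>0. \<forall>s\<in>{0..1}. \<forall>t\<in>{0..1}. \<forall>s'\<in>{0..1}. \<forall>t'\<in>{0..1}.
            dist (H (s, t)) (H (s', t')) \<le> L * (\<bar>s - s'\<bar> + \<bar>t - t'\<bar>)) \<and>
        (\<forall>s\<in>{0..1}. H (s, 0) = \<gamma> s) \<and>
        (\<forall>s\<in>{0..1}. H (s, 1) = \<gamma>' s) \<and>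
        (\<forall>t\<in>{0..1}. H (0, t) = \<gamma> 0) \<and>
        (\<forall>t\<in>{0..1}. H (1, t) = \<gamma> 1))"

definition lip_class ::
    "'a::metric_space set \<Rightarrow> (real \<Rightarrow> 'a) \<Rightarrow> (real \<Rightarrow> 'a) set" where
  "lip_class M \<gamma> = {\<gamma>'. lip_homotopic M \<gamma> \<gamma>'}"

text \<open>
  \<open>[\<alpha>] * [\<gamma>] = [\<alpha> * \<gamma>]\<close>, written without a choice of representatives: all the classes in the
  union coincide when the paths are composable.
\<close>

definition class_concat ::
    "'a::metric_space set \<Rightarrow> (real \<Rightarrow> 'a) set \<Rightarrow> (real \<Rightarrow> 'a) set \<Rightarrow> (real \<Rightarrow> 'a) set" where
  "class_concat M A B = (\<Union>\<alpha>\<in>A. \<Union>\<gamma>\<in>B. lip_class M (\<alpha> +++ \<gamma>))"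

definition lip_pi1 :: "'a::metric_space set \<Rightarrow> 'a \<Rightarrow> (real \<Rightarrow> 'a) set monoid" where
  "lip_pi1 M p0 =
     \<lparr>carrier = {lip_class M \<alpha> | \<alpha>. lip_path M \<alpha> \<and> pathstart \<alpha> = p0 \<and> pathfinish \<alpha> = p0},
      mult = class_concat M,
      one = lip_class M (\<lambda>_. p0)\<rparr>"

definition lip_path_space :: "'a::metric_space set \<Rightarrow> 'a \<Rightarrow> (real \<Rightarrow> 'a) set set" where
  "lip_path_space M p0 = {lip_class M \<gamma> | \<gamma>. lip_path M \<gamma> \<and> pathstart \<gamma> = p0}"

text \<open>
  The infimum ranges over all representatives of both classes; since homotopy is compatible with
  concatenation and reversal, every choice of representatives gives the same set of paths \<open>\<beta>\<close>.
\<close>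

definition lifted_dist ::
    "'a::metric_space set \<Rightarrow> (real \<Rightarrow> 'a) set \<Rightarrow> (real \<Rightarrow> 'a) set \<Rightarrow> real" where
  "lifted_dist M A B =
     Inf {curve_length \<beta> | \<beta>.
            \<exists>\<gamma>1\<in>A. \<exists>\<gamma>2\<in>B. lip_homotopic M \<beta> (reversepath \<gamma>1 +++ \<gamma>2)}"

text \<open>
  The restriction to the path space is needed because the permutations in \<^const>\<open>BijGroup\<close> are
  extensional functions.
\<close>

definition concat_action ::
    "'a::metric_space set \<Rightarrow> 'a \<Rightarrow> (real \<Rightarrow> 'a) set \<Rightarrow> (real \<Rightarrow> 'a) set \<Rightarrow> (real \<Rightarrow> 'a) set" where
  "concat_action M p0 A = (\<lambda>X \<in> lip_path_space M p0. class_concat M A X)"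

end

theory Submission
  imports Defs
begin

text \<open>
  Every assertion about classes is a calculation with paths up to homotopy. That calculus needs two
  inputs. First, homotopies can be concatenated in either parameter, so \<open>\<simeq>\<close> is an equivalence
  relation compatible with \<open>+++\<close> and \<open>reversepath\<close>; hence \<open>[\<alpha>] * [\<gamma>] = [\<alpha> +++ \<gamma>]\<close> holds for
  \<^const>\<open>class_concat\<close>. Because \<open>I \<times> I\<close> carries the \<open>L\<^sup>1\<close> metric, a map on the square is Lipschitz
  as soon as it is Lipschitz in each variable with a constant independent of the other variable, so
  gluing homotopies reduces to gluing functions of one real variable. Second, if two Lipschitz maps
  \<open>\<phi>, \<psi> : I \<rightarrow> I\<close> agree at 0 and at 1, then \<open>\<gamma> \<circ> \<phi> \<simeq> \<gamma> \<circ> \<psi>\<close>, by moving from \<open>\<phi>\<close> to \<open>\<psi>\<close> along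
  line segments. The unit, inverse and associative laws are all instances of this fact, for
  piecewise linear \<open>\<phi>\<close> and \<open>\<psi>\<close>.

  The groupoid laws make \<open>\<pi>\<^sub>1\<close> a group and give the axioms of an action. The action is free because
  \<open>\<gamma>\<close> can be cancelled on the right of \<open>\<alpha> +++ \<gamma> \<simeq> \<gamma>\<close> by concatenating with its inverse path. It
  is isometric because \<open>\<alpha>\<close> cancels in
  \<open>reversepath (\<alpha> +++ \<gamma>\<^sub>1) +++ (\<alpha> +++ \<gamma>\<^sub>2) \<simeq> reversepath \<gamma>\<^sub>1 +++ \<gamma>\<^sub>2\<close>, so that both distances are
  infima of lengths over the same set of paths.
\<close>

section \<open>Lipschitz homotopies\<close>

text \<open>
  A homotopy as a curried function, with the joint Lipschitz condition replaced by the two separate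
  ones; \<open>lip_homotopic_iff\<close> shows that this gives the same relation.
\<close>

definition sep_lip_homotopy ::
    "'a::metric_space set \<Rightarrow> real \<Rightarrow> (real \<Rightarrow> real \<Rightarrow> 'a) \<Rightarrow> (real \<Rightarrow> 'a) \<Rightarrow> (real \<Rightarrow> 'a) \<Rightarrow> bool" where
  "sep_lip_homotopy M L H \<gamma> \<gamma>' \<longleftrightarrow>
     (\<forall>s\<in>{0..1}. \<forall>t\<in>{0..1}. H s t \<in> M) \<and>
     (\<forall>t\<in>{0..1}. L-lipschitz_on {0..1} (\<lambda>s. H s t)) \<and>
     (\<forall>s\<in>{0..1}. L-lipschitz_on {0..1} (H s)) \<and>
     (\<forall>s\<in>{0..1}. H s 0 = \<gamma> s) \<and>
     (\<forall>s\<in>{0..1}. H s 1 = \<gamma>' s) \<and>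
     (\<forall>t\<in>{0..1}. H 0 t = \<gamma> 0) \<and>
     (\<forall>t\<in>{0..1}. H 1 t = \<gamma> 1)"

lemma sep_lip_homotopyD:
  assumes "sep_lip_homotopy M L H \<gamma> \<gamma>'"
  shows "\<And>s t. s \<in> {0..1} \<Longrightarrow> t \<in> {0..1} \<Longrightarrow> H s t \<in> M"
    and "\<And>t. t \<in> {0..1} \<Longrightarrow> L-lipschitz_on {0..1} (\<lambda>s. H s t)"
    and "\<And>s. s \<in> {0..1} \<Longrightarrow> L-lipschitz_on {0..1} (H s)"
    and "\<And>s. s \<in> {0..1} \<Longrightarrow> H s 0 = \<gamma> s"
    and "\<And>s. s \<in> {0..1} \<Longrightarrow> H s 1 = \<gamma>' s"
    and "\<And>t. t \<in> {0..1} \<Longrightarrow> H 0 t = \<gamma> 0"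
    and "\<And>t. t \<in> {0..1} \<Longrightarrow> H 1 t = \<gamma> 1"
  using assms unfolding sep_lip_homotopy_def by blast+

lemma sep_lip_homotopyI:
  assumes "\<And>s t. s \<in> {0..1} \<Longrightarrow> t \<in> {0..1} \<Longrightarrow> H s t \<in> M"
    and "\<And>t. t \<in> {0..1} \<Longrightarrow> L-lipschitz_on {0..1} (\<lambda>s. H s t)"
    and "\<And>s. s \<in> {0..1} \<Longrightarrow> L-lipschitz_on {0..1} (H s)"
    and "\<And>s. s \<in> {0..1} \<Longrightarrow> H s 0 = \<gamma> s"
    and "\<And>s. s \<in> {0..1} \<Longrightarrow> H s 1 = \<gamma>' s"
    and "\<And>t. t \<in> {0..1} \<Longrightarrow> H 0 t = \<gamma> 0"
    and "\<And>t. t \<in> {0..1} \<Longrightarrow> H 1 t = \<gamma> 1"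
  shows "sep_lip_homotopy M L H \<gamma> \<gamma>'"
  using assms unfolding sep_lip_homotopy_def by blast

text \<open>
  Separate Lipschitz conditions with a common constant imply the joint one by moving first in one
  coordinate direction and then in the other: the length of that route is the \<open>L\<^sup>1\<close> distance.
\<close>

lemma sep_lip_homotopy_imp_lip_homotopic:
  assumes "sep_lip_homotopy M L H \<gamma> \<gamma>'"
  shows "lip_homotopic M \<gamma> \<gamma>'"
proof -
  note H = sep_lip_homotopyD[OF assms]
  have "L-lipschitz_on {0..1} \<gamma>" "L-lipschitz_on {0..1} \<gamma>'"
    using H(2)[of 0] H(2)[of 1] H(4,5) by (auto simp: lipschitz_on_def)
  moreover have "\<gamma> ` {0..1} \<subseteq> M" "\<gamma>' ` {0..1} \<subseteq> M"
    using H(1)[of _ 0] H(1)[of _ 1] H(4,5) by force+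
  moreover have "\<gamma>' 0 = \<gamma> 0" "\<gamma>' 1 = \<gamma> 1"
    using H(5)[of 0] H(5)[of 1] H(6)[of 1] H(7)[of 1] by auto
  moreover have "dist (H s t) (H s' t') \<le> L * (\<bar>s - s'\<bar> + \<bar>t - t'\<bar>)"
    if "s \<in> {0..1}" "t \<in> {0..1}" "s' \<in> {0..1}" "t' \<in> {0..1}" for s t s' t'
  proof -
    have "dist (H s t) (H s' t') \<le> dist (H s t) (H s' t) + dist (H s' t) (H s' t')"
      by (rule dist_triangle)
    also have "\<dots> \<le> L * dist s s' + L * dist t t'"
      using lipschitz_onD[OF H(2)] lipschitz_onD[OF H(3)] that by (intro add_mono) auto
    finally show ?thesis by (simp add: dist_real_def algebra_simps)
  qed
  moreover have "L \<ge> 0" using H(2)[of 0] by (auto dest: lipschitz_on_nonneg)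
  ultimately show ?thesis
    unfolding lip_homotopic_def lip_path_def path_image_def pathstart_def pathfinish_def
    using H(1,4-7)
    by (auto intro!: exI[of _ "\<lambda>(s, t). H s t"] exI[of _ L])
qed

lemmas lip_homotopicI = sep_lip_homotopy_imp_lip_homotopic[OF sep_lip_homotopyI]

lemma lip_homotopic_iff:
  "lip_homotopic M \<gamma> \<gamma>' \<longleftrightarrow> (\<exists>L H. sep_lip_homotopy M L H \<gamma> \<gamma>')"
proof
  assume "lip_homotopic M \<gamma> \<gamma>'"
  then obtain H L where img: "H ` ({0..1} \<times> {0..1}) \<subseteq> M" and "L \<ge> 0"
    and lip: "\<forall>s\<in>{0..1}. \<forall>t\<in>{0..1}. \<forall>s'\<in>{0..1}. \<forall>t'\<in>{0..1}.
       dist (H (s, t)) (H (s', t')) \<le> L * (\<bar>s - s'\<bar> + \<bar>t - t'\<bar>)"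
    and bd: "\<forall>s\<in>{0..1}. H (s, 0) = \<gamma> s" "\<forall>s\<in>{0..1}. H (s, 1) = \<gamma>' s"
      "\<forall>t\<in>{0..1}. H (0, t) = \<gamma> 0" "\<forall>t\<in>{0..1}. H (1, t) = \<gamma> 1"
    unfolding lip_homotopic_def by blast
  have "L-lipschitz_on {0..1} (\<lambda>s. H (s, t))" if "t \<in> {0..1}" for t
    using lip[THEN bspec, THEN bspec, THEN bspec, THEN bspec, of _ t _ t] that \<open>L \<ge> 0\<close>
    by (auto intro!: lipschitz_onI simp: dist_real_def)
  moreover have "L-lipschitz_on {0..1} (\<lambda>t. H (s, t))" if "s \<in> {0..1}" for s
    using lip[THEN bspec, THEN bspec, THEN bspec, THEN bspec, of s _ s] that \<open>L \<ge> 0\<close>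
    by (auto intro!: lipschitz_onI simp: dist_real_def)
  ultimately have "sep_lip_homotopy M L (\<lambda>s t. H (s, t)) \<gamma> \<gamma>'"
    unfolding sep_lip_homotopy_def using img bd by (auto simp: image_subset_iff)
  then show "\<exists>L H. sep_lip_homotopy M L H \<gamma> \<gamma>'" by blast
qed (auto intro: sep_lip_homotopy_imp_lip_homotopic)

lemma lip_homotopic_imp_lip_path:
  assumes "lip_homotopic M \<gamma> \<gamma>'"
  shows "lip_path M \<gamma>" "lip_path M \<gamma>'"
  using assms by (auto simp: lip_homotopic_def)

lemma lip_homotopic_imp_endpoints:
  assumes "lip_homotopic M \<gamma> \<gamma>'"
  shows "pathstart \<gamma>' = pathstart \<gamma>" "pathfinish \<gamma>' = pathfinish \<gamma>"
  using assms by (auto simp: lip_homotopic_def)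

lemma lipschitz_on_joinpaths:
  assumes f: "L-lipschitz_on {0..1} f" and g: "L-lipschitz_on {0..1} g" and "f 1 = g 0"
  shows "(2 * L)-lipschitz_on {0..1} (f +++ g)"
proof -
  have "(L * 2)-lipschitz_on {0..1/2} (\<lambda>x. f (2 * x))"
    by (rule lipschitz_on_compose2[where f = "\<lambda>x. 2 * x" and g = f])
      (auto intro!: lipschitz_onI lipschitz_on_subset[OF f] simp: dist_real_def abs_if)
  moreover have "(L * 2)-lipschitz_on {1/2..1} (\<lambda>x. g (2 * x - 1))"
    by (rule lipschitz_on_compose2[where f = "\<lambda>x. 2 * x - 1" and g = g])
      (auto intro!: lipschitz_onI lipschitz_on_subset[OF g] simp: dist_real_def abs_if)
  ultimately have "(L * 2)-lipschitz_on {0..1} (\<lambda>x. if x \<le> 1/2 then f (2 * x) else g (2 * x - 1))"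
    using \<open>f 1 = g 0\<close> by (intro lipschitz_on_concat) auto
  then show ?thesis by (simp add: joinpaths_def mult.commute)
qed

lemma lipschitz_on_reversepath:
  assumes "L-lipschitz_on {0..1} f"
  shows "L-lipschitz_on {0..1} (reversepath f)"
proof (rule lipschitz_onI)
  fix x y :: real assume "x \<in> {0..1}" "y \<in> {0..1}"
  then have "dist (f (1 - x)) (f (1 - y)) \<le> L * dist (1 - x) (1 - y)"
    by (intro lipschitz_onD[OF assms]) auto
  then show "dist (reversepath f x) (reversepath f y) \<le> L * dist x y"
    by (simp add: reversepath_def dist_real_def abs_minus_commute)
qed (use assms lipschitz_on_nonneg in blast)

lemma lip_path_join:
  assumes "lip_path M \<gamma>" "lip_path M \<delta>" "pathfinish \<gamma> = pathstart \<delta>"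
  shows "lip_path M (\<gamma> +++ \<delta>)"
proof -
  obtain K L where "K-lipschitz_on {0..1} \<gamma>" "L-lipschitz_on {0..1} \<delta>"
    using assms by (auto simp: lip_path_def)
  then have "(max K L)-lipschitz_on {0..1} \<gamma>" "(max K L)-lipschitz_on {0..1} \<delta>"
    by (auto intro: lipschitz_on_le)
  then show ?thesis
    using assms lipschitz_on_joinpaths unfolding lip_path_def
    by (metis pathfinish_def pathstart_def subset_path_image_join)
qed

lemma lip_path_reversepath:
  "lip_path M \<gamma> \<Longrightarrow> lip_path M (reversepath \<gamma>)"
  unfolding lip_path_def using lipschitz_on_reversepath by (metis path_image_reversepath)

lemma lip_path_const: "p \<in> M \<Longrightarrow> lip_path M (\<lambda>_. p)"
  by (auto simp: lip_path_def path_image_def lipschitz_on_def)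

lemma lip_path_pathstart: "lip_path M \<gamma> \<Longrightarrow> pathstart \<gamma> \<in> M"
  by (auto simp: lip_path_def)

text \<open>
  The homotopy moves the parameter along the segment from \<open>\<phi> s\<close> to \<open>\<psi> s\<close>, which stays in \<open>I\<close> by
  convexity.
\<close>

lemma lip_homotopic_reparametrizations:
  assumes "lip_path M \<gamma>"
    and \<phi>: "K-lipschitz_on {0..1} \<phi>" "\<phi> \<in> {0..1} \<rightarrow> {0..1}"
    and \<psi>: "K-lipschitz_on {0..1} \<psi>" "\<psi> \<in> {0..1} \<rightarrow> {0..1}"
    and ends: "\<phi> 0 = \<psi> 0" "\<phi> 1 = \<psi> 1"
  shows "lip_homotopic M (\<gamma> \<circ> \<phi>) (\<gamma> \<circ> \<psi>)"
proof -
  obtain L where L: "L-lipschitz_on {0..1} \<gamma>" and img: "\<gamma> ` {0..1} \<subseteq> M"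
    using assms(1) by (auto simp: lip_path_def path_image_def)
  have "L \<ge> 0" using L by (rule lipschitz_on_nonneg)
  have "K \<ge> 0" using \<phi>(1) by (rule lipschitz_on_nonneg)
  define h where "h s t = (1 - t) * \<phi> s + t * \<psi> s" for s t
  have h_in: "h s t \<in> {0..1}" if "s \<in> {0..1}" "t \<in> {0..1}" for s t
    using convexD[OF convex_closed_interval, of "\<phi> s" 0 1 "\<psi> s" "1 - t" t] that \<phi>(2) \<psi>(2)
    by (auto simp: h_def cbox_interval Pi_def)
  have h_s: "K-lipschitz_on {0..1} (\<lambda>s. h s t)" if t: "t \<in> {0..1}" for t
  proof (rule lipschitz_onI[OF _ \<open>K \<ge> 0\<close>])
    fix x y :: real assume xy: "x \<in> {0..1}" "y \<in> {0..1}"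
    have "dist (h x t) (h y t) = \<bar>(1 - t) * (\<phi> x - \<phi> y) + t * (\<psi> x - \<psi> y)\<bar>"
      by (simp add: h_def dist_real_def algebra_simps)
    also have "\<dots> \<le> \<bar>(1 - t) * (\<phi> x - \<phi> y)\<bar> + \<bar>t * (\<psi> x - \<psi> y)\<bar>"
      by (rule abs_triangle_ineq)
    also have "\<dots> = (1 - t) * dist (\<phi> x) (\<phi> y) + t * dist (\<psi> x) (\<psi> y)"
      using t by (simp add: abs_mult dist_real_def)
    also have "\<dots> \<le> (1 - t) * (K * dist x y) + t * (K * dist x y)"
      using t xy lipschitz_onD[OF \<phi>(1)] lipschitz_onD[OF \<psi>(1)]
      by (intro add_mono mult_left_mono) auto
    finally show "dist (h x t) (h y t) \<le> K * dist x y" by (simp add: algebra_simps)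
  qed
  have h_t: "1-lipschitz_on {0..1} (\<lambda>t. h s t)" if s: "s \<in> {0..1}" for s
  proof (rule lipschitz_onI)
    fix x y :: real
    have "dist (h s x) (h s y) = \<bar>(x - y) * (\<psi> s - \<phi> s)\<bar>"
      by (simp add: h_def dist_real_def algebra_simps)
    also have "\<dots> = \<bar>x - y\<bar> * \<bar>\<psi> s - \<phi> s\<bar>" by (rule abs_mult)
    also have "\<dots> \<le> \<bar>x - y\<bar> * 1"
    proof (rule mult_left_mono)
      have "\<phi> s \<in> {0..1}" "\<psi> s \<in> {0..1}" using s \<phi>(2) \<psi>(2) by auto
      then show "\<bar>\<psi> s - \<phi> s\<bar> \<le> 1" by auto
    qed simp
    finally show "dist (h s x) (h s y) \<le> 1 * dist x y" by (simp add: dist_real_def)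
  qed simp
  let ?C = "L * max K 1"
  show ?thesis
  proof (rule lip_homotopicI[where H = "\<lambda>s t. \<gamma> (h s t)" and L = ?C])
    show "?C-lipschitz_on {0..1} (\<lambda>s. \<gamma> (h s t))" if "t \<in> {0..1}" for t
      using h_in that
      by (intro lipschitz_on_compose2[where g = \<gamma>] lipschitz_on_subset[OF L]
          lipschitz_on_le[OF h_s]) auto
    show "?C-lipschitz_on {0..1} (\<lambda>t. \<gamma> (h s t))" if "s \<in> {0..1}" for s
      using h_in that
      by (intro lipschitz_on_compose2[where g = \<gamma>] lipschitz_on_subset[OF L]
          lipschitz_on_le[OF h_t]) auto
  next
    show "\<gamma> (h s t) \<in> M" if "s \<in> {0..1}" "t \<in> {0..1}" for s t
      using img h_in[OF that] by auto
  qed (simp_all add: h_def ends algebra_simps)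
qed

lemma lip_homotopic_refl:
  assumes "lip_path M \<gamma>"
  shows "lip_homotopic M \<gamma> \<gamma>"
  using lip_homotopic_reparametrizations[OF assms lipschitz_on_id _ lipschitz_on_id]
  by (auto simp: comp_def id_def)

lemma lip_homotopic_sym:
  assumes "lip_homotopic M \<gamma> \<gamma>'"
  shows "lip_homotopic M \<gamma>' \<gamma>"
proof -
  have ends: "\<gamma>' 0 = \<gamma> 0" "\<gamma>' 1 = \<gamma> 1"
    using lip_homotopic_imp_endpoints[OF assms] by (auto simp: pathstart_def pathfinish_def)
  from assms obtain L H where "sep_lip_homotopy M L H \<gamma> \<gamma>'"
    by (auto simp: lip_homotopic_iff)
  note H = sep_lip_homotopyD[OF this]
  show ?thesis
  proof (rule lip_homotopicI[where H = "\<lambda>s. reversepath (H s)" and L = L])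
    show "L-lipschitz_on {0..1} (\<lambda>s. reversepath (H s) t)" if "t \<in> {0..1}" for t
      using H(2)[of "1 - t"] that by (simp add: reversepath_def)
    show "L-lipschitz_on {0..1} (\<lambda>t. reversepath (H s) t)" if "s \<in> {0..1}" for s
      using lipschitz_on_reversepath[OF H(3)[OF that]] by simp
  qed (use H ends in \<open>auto simp: reversepath_def\<close>)
qed

text \<open>
  Concatenating homotopies in the parameter \<open>t\<close> gives transitivity, and in the parameter \<open>s\<close>
  compatibility with \<open>+++\<close>. In either case the constant at most doubles in the direction of
  concatenation, and in the other direction each slice belongs to one of the two homotopies.
\<close>

lemma lip_homotopic_trans [trans]:
  assumes "lip_homotopic M \<alpha> \<beta>" "lip_homotopic M \<beta> \<gamma>"
  shows "lip_homotopic M \<alpha> \<gamma>"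
proof -
  have ends: "\<beta> 0 = \<alpha> 0" "\<beta> 1 = \<alpha> 1"
    using lip_homotopic_imp_endpoints[OF assms(1)] by (auto simp: pathstart_def pathfinish_def)
  from assms(1) obtain K F where "sep_lip_homotopy M K F \<alpha> \<beta>"
    by (auto simp: lip_homotopic_iff)
  note F = sep_lip_homotopyD[OF this]
  from assms(2) obtain L G where "sep_lip_homotopy M L G \<beta> \<gamma>"
    by (auto simp: lip_homotopic_iff)
  note G = sep_lip_homotopyD[OF this]
  define C where "C = max K L"
  have "C \<ge> 0" using lipschitz_on_nonneg[OF F(2)[of 0]] by (simp add: C_def)
  have C: "K \<le> C" "L \<le> C" by (auto simp: C_def)
  show ?thesis
  proof (rule lip_homotopicI[where H = "\<lambda>s. F s +++ G s" and L = "2 * C"])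
    fix t :: real assume t: "t \<in> {0..1}"
    show "(2 * C)-lipschitz_on {0..1} (\<lambda>s. (F s +++ G s) t)"
    proof (cases "t \<le> 1/2")
      case True
      then show ?thesis
        using lipschitz_on_le[OF F(2)[of "2 * t"], of "2 * C"] t C \<open>C \<ge> 0\<close>
        by (simp add: joinpaths_def)
    next
      case False
      then show ?thesis
        using lipschitz_on_le[OF G(2)[of "2 * t - 1"], of "2 * C"] t C \<open>C \<ge> 0\<close>
        by (simp add: joinpaths_def)
    qed
  next
    fix s :: real assume s: "s \<in> {0..1}"
    have "(2 * C)-lipschitz_on {0..1} (F s +++ G s)"
      using s by (intro lipschitz_on_joinpaths lipschitz_on_le[OF F(3)] lipschitz_on_le[OF G(3)] C)
        (simp_all add: F(5) G(4))
    then show "(2 * C)-lipschitz_on {0..1} (\<lambda>t. (F s +++ G s) t)" by simp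
  qed (use F G ends in \<open>auto simp: joinpaths_def\<close>)
qed

lemma lip_homotopic_join:
  assumes "lip_homotopic M \<alpha> \<alpha>'" "lip_homotopic M \<gamma> \<gamma>'" "pathfinish \<alpha> = pathstart \<gamma>"
  shows "lip_homotopic M (\<alpha> +++ \<gamma>) (\<alpha>' +++ \<gamma>')"
proof -
  have ends: "\<alpha> 1 = \<gamma> 0" using assms(3) by (simp add: pathstart_def pathfinish_def)
  from assms(1) obtain K F where "sep_lip_homotopy M K F \<alpha> \<alpha>'"
    by (auto simp: lip_homotopic_iff)
  note F = sep_lip_homotopyD[OF this]
  from assms(2) obtain L G where "sep_lip_homotopy M L G \<gamma> \<gamma>'"
    by (auto simp: lip_homotopic_iff)
  note G = sep_lip_homotopyD[OF this]
  define C where "C = max K L"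
  have "C \<ge> 0" using lipschitz_on_nonneg[OF F(2)[of 0]] by (simp add: C_def)
  have C: "K \<le> C" "L \<le> C" by (auto simp: C_def)
  show ?thesis
  proof (rule lip_homotopicI[where H = "\<lambda>s t. ((\<lambda>r. F r t) +++ (\<lambda>r. G r t)) s" and L = "2 * C"])
    fix s :: real assume s: "s \<in> {0..1}"
    show "(2 * C)-lipschitz_on {0..1} (\<lambda>t. ((\<lambda>r. F r t) +++ (\<lambda>r. G r t)) s)"
    proof (cases "s \<le> 1/2")
      case True
      then show ?thesis
        using lipschitz_on_le[OF F(3)[of "2 * s"], of "2 * C"] s C \<open>C \<ge> 0\<close>
        by (simp add: joinpaths_def)
    next
      case False
      then show ?thesis
        using lipschitz_on_le[OF G(3)[of "2 * s - 1"], of "2 * C"] s C \<open>C \<ge> 0\<close>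
        by (simp add: joinpaths_def)
    qed
  next
    fix t :: real assume t: "t \<in> {0..1}"
    have "(2 * C)-lipschitz_on {0..1} ((\<lambda>r. F r t) +++ (\<lambda>r. G r t))"
      using t ends
      by (intro lipschitz_on_joinpaths lipschitz_on_le[OF F(2)] lipschitz_on_le[OF G(2)] C)
        (simp_all add: F(7) G(6))
    then show "(2 * C)-lipschitz_on {0..1} (\<lambda>s. ((\<lambda>r. F r t) +++ (\<lambda>r. G r t)) s)" by simp
  qed (use F G ends in \<open>auto simp: joinpaths_def\<close>)
qed

lemma lip_homotopic_reversepath:
  assumes "lip_homotopic M \<gamma> \<gamma>'"
  shows "lip_homotopic M (reversepath \<gamma>) (reversepath \<gamma>')"
proof -
  from assms obtain L H where "sep_lip_homotopy M L H \<gamma> \<gamma>'"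
    by (auto simp: lip_homotopic_iff)
  note H = sep_lip_homotopyD[OF this]
  show ?thesis
  proof (rule lip_homotopicI[where H = "\<lambda>s t. H (1 - s) t" and L = L])
    show "L-lipschitz_on {0..1} (\<lambda>s. H (1 - s) t)" if "t \<in> {0..1}" for t
      using lipschitz_on_reversepath[OF H(2)[OF that]] by (simp add: reversepath_def)
  qed (use H in \<open>auto simp: reversepath_def\<close>)
qed

section \<open>The groupoid laws up to homotopy\<close>

lemma lip_homotopic_reparametrization:
  assumes "lip_path M \<gamma>" "K-lipschitz_on {0..1} \<phi>" "\<phi> \<in> {0..1} \<rightarrow> {0..1}" "\<phi> 0 = 0" "\<phi> 1 = 1"
  shows "lip_homotopic M (\<gamma> \<circ> \<phi>) \<gamma>"
proof -
  have "lip_homotopic M (\<gamma> \<circ> \<phi>) (\<gamma> \<circ> (\<lambda>s. s))"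
    using assms(3-5)
    by (intro lip_homotopic_reparametrizations[where K = "max K 1"] assms(1)
        lipschitz_on_le[OF assms(2)] lipschitz_on_le[OF lipschitz_on_id]) auto
  then show ?thesis by (simp add: comp_def)
qed

lemma lip_homotopic_const_join:
  assumes "lip_path M \<gamma>" "pathstart \<gamma> = p"
  shows "lip_homotopic M ((\<lambda>_. p) +++ \<gamma>) \<gamma>"
proof -
  have "(\<lambda>_. p) +++ \<gamma> = \<gamma> \<circ> (\<lambda>s. max 0 (2 * s - 1))"
    using assms(2)
    by (auto simp: joinpaths_def pathstart_def max_absorb1 max_absorb2 fun_eq_iff)
  moreover have "2-lipschitz_on {0..1} (\<lambda>s::real. max 0 (2 * s - 1))"
    by (intro lipschitz_onI) (auto simp: dist_real_def max_def abs_if)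
  ultimately show ?thesis
    using lip_homotopic_reparametrization[OF assms(1)] by fastforce
qed

lemma lip_homotopic_join_const:
  assumes "lip_path M \<gamma>" "pathfinish \<gamma> = p"
  shows "lip_homotopic M (\<gamma> +++ (\<lambda>_. p)) \<gamma>"
proof -
  have "\<gamma> +++ (\<lambda>_. p) = \<gamma> \<circ> (\<lambda>s. min 1 (2 * s))"
    using assms(2)
    by (auto simp: joinpaths_def pathfinish_def min_absorb1 min_absorb2 fun_eq_iff)
  moreover have "2-lipschitz_on {0..1} (\<lambda>s::real. min 1 (2 * s))"
    by (intro lipschitz_onI) (auto simp: dist_real_def min_def abs_if)
  ultimately show ?thesis
    using lip_homotopic_reparametrization[OF assms(1)] by fastforce
qed

text \<open>
  Both paths are reparametrizations of \<open>\<gamma>\<close>: going there and back follows a tent function, and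
  the constant path follows the constant function 0.
\<close>

lemma lip_homotopic_join_reversepath:
  assumes "lip_path M \<gamma>" "pathstart \<gamma> = p"
  shows "lip_homotopic M (\<gamma> +++ reversepath \<gamma>) (\<lambda>_. p)"
proof -
  have "\<gamma> +++ reversepath \<gamma> = \<gamma> \<circ> (\<lambda>s. min (2 * s) (2 - 2 * s))"
    by (auto simp: joinpaths_def reversepath_def min_def fun_eq_iff)
  moreover have "p = \<gamma> 0"
    using assms(2) by (simp add: pathstart_def)
  moreover have "2-lipschitz_on {0..1} (\<lambda>s::real. min (2 * s) (2 - 2 * s))"
    by (intro lipschitz_onI) (auto simp: dist_real_def min_def abs_if)
  moreover have "2-lipschitz_on {0..1} (\<lambda>s::real. 0::real)"
    by (intro lipschitz_onI) auto
  moreover have "(\<lambda>s::real. min (2 * s) (2 - 2 * s)) \<in> {0..1} \<rightarrow> {0..1}"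
    by (auto simp: min_def)
  ultimately show ?thesis
    using lip_homotopic_reparametrizations[OF assms(1), of 2 "\<lambda>s. min (2 * s) (2 - 2 * s)" "\<lambda>_. 0"]
    by (simp add: comp_def)
qed

lemma lip_homotopic_reversepath_join:
  assumes "lip_path M \<gamma>" "pathfinish \<gamma> = p"
  shows "lip_homotopic M (reversepath \<gamma> +++ \<gamma>) (\<lambda>_. p)"
  using lip_homotopic_join_reversepath[OF lip_path_reversepath[OF assms(1)]] assms(2) by simp

lemma lip_homotopic_assoc:
  assumes "lip_path M \<alpha>" "lip_path M \<beta>" "lip_path M \<gamma>"
    and "pathfinish \<alpha> = pathstart \<beta>" "pathfinish \<beta> = pathstart \<gamma>"
  shows "lip_homotopic M ((\<alpha> +++ \<beta>) +++ \<gamma>) (\<alpha> +++ (\<beta> +++ \<gamma>))"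
proof -
  \<comment> \<open>the slopes 2, 1 and 1/2 turn the breakpoints 1/4 and 1/2 of the left-hand side into the
    breakpoints 1/2 and 3/4 of the right-hand side; the slopes decrease, so a minimum of affine
    functions describes the change of parameter\<close>
  define \<phi> :: "real \<Rightarrow> real" where "\<phi> s = min (2 * s) (min (s + 1/4) (s/2 + 1/2))" for s
  have "(\<alpha> +++ \<beta>) +++ \<gamma> = (\<alpha> +++ (\<beta> +++ \<gamma>)) \<circ> \<phi>"
  proof
    fix s :: real
    consider "s \<le> 1/4" | "1/4 < s" "s \<le> 1/2" | "1/2 < s" by linarith
    then show "((\<alpha> +++ \<beta>) +++ \<gamma>) s = ((\<alpha> +++ (\<beta> +++ \<gamma>)) \<circ> \<phi>) s"
    proof cases
      case 1
      then have "\<phi> s = 2 * s" by (auto simp: \<phi>_def min_def)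
      with 1 show ?thesis by (simp add: joinpaths_def)
    next
      case 2
      then have "\<phi> s = s + 1/4" by (auto simp: \<phi>_def min_def)
      with 2 show ?thesis by (simp add: joinpaths_def algebra_simps)
    next
      case 3
      then have "\<phi> s = s/2 + 1/2" by (auto simp: \<phi>_def min_def)
      with 3 show ?thesis by (simp add: joinpaths_def algebra_simps)
    qed
  qed
  moreover have "2-lipschitz_on {0..1} \<phi>"
    by (intro lipschitz_onI) (auto simp: dist_real_def \<phi>_def min_def abs_if)
  moreover have "\<phi> \<in> {0..1} \<rightarrow> {0..1}" "\<phi> 0 = 0" "\<phi> 1 = 1"
    by (auto simp: \<phi>_def min_def)
  moreover have "lip_path M (\<alpha> +++ (\<beta> +++ \<gamma>))"
    using assms by (intro lip_path_join) auto
  ultimately show ?thesis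
    using lip_homotopic_reparametrization by metis
qed

lemma lip_homotopic_cancel_left:
  assumes "lip_path M \<alpha>" "lip_path M \<gamma>" "pathfinish \<alpha> = pathstart \<gamma>"
  shows "lip_homotopic M (reversepath \<alpha> +++ (\<alpha> +++ \<gamma>)) \<gamma>"
proof -
  have "lip_homotopic M (reversepath \<alpha> +++ (\<alpha> +++ \<gamma>)) ((reversepath \<alpha> +++ \<alpha>) +++ \<gamma>)"
    using assms by (intro lip_homotopic_sym[OF lip_homotopic_assoc] lip_path_reversepath) auto
  also have "lip_homotopic M \<dots> ((\<lambda>_. pathstart \<gamma>) +++ \<gamma>)"
    using assms
    by (intro lip_homotopic_join lip_homotopic_reversepath_join lip_homotopic_refl) auto
  also have "lip_homotopic M \<dots> \<gamma>"
    using assms by (intro lip_homotopic_const_join) auto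
  finally show ?thesis .
qed

lemma lip_homotopic_cancel_right:
  assumes "lip_path M \<alpha>" "lip_path M \<gamma>" "pathfinish \<alpha> = pathstart \<gamma>"
  shows "lip_homotopic M ((\<alpha> +++ \<gamma>) +++ reversepath \<gamma>) \<alpha>"
proof -
  have "lip_homotopic M ((\<alpha> +++ \<gamma>) +++ reversepath \<gamma>) (\<alpha> +++ (\<gamma> +++ reversepath \<gamma>))"
    using assms by (intro lip_homotopic_assoc lip_path_reversepath) auto
  also have "lip_homotopic M \<dots> (\<alpha> +++ (\<lambda>_. pathfinish \<alpha>))"
    using assms
    by (intro lip_homotopic_join lip_homotopic_join_reversepath lip_homotopic_refl) auto
  also have "lip_homotopic M \<dots> \<alpha>"
    using assms by (intro lip_homotopic_join_const) auto
  finally show ?thesis .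
qed

section \<open>Homotopy classes\<close>

lemma lip_class_self: "lip_path M \<gamma> \<Longrightarrow> \<gamma> \<in> lip_class M \<gamma>"
  by (simp add: lip_class_def lip_homotopic_refl)

lemma lip_class_eqI: "lip_homotopic M \<gamma> \<gamma>' \<Longrightarrow> lip_class M \<gamma> = lip_class M \<gamma>'"
  unfolding lip_class_def by (blast intro: lip_homotopic_trans lip_homotopic_sym)

lemma lip_class_eq_iff:
  "lip_path M \<gamma>' \<Longrightarrow> lip_class M \<gamma> = lip_class M \<gamma>' \<longleftrightarrow> lip_homotopic M \<gamma> \<gamma>'"
  using lip_class_eqI lip_class_self by (fastforce simp: lip_class_def)

text \<open>
  The union in \<^const>\<open>class_concat\<close> collapses to a single class because homotopy is compatible with
  concatenation. The same compatibility frees the infimum in \<^const>\<open>lifted_dist\<close> from the choice of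
  representatives in \<open>lifted_dist_lip_class\<close>.
\<close>

lemma class_concat_lip_class:
  assumes "lip_path M \<alpha>" "lip_path M \<gamma>" "pathfinish \<alpha> = pathstart \<gamma>"
  shows "class_concat M (lip_class M \<alpha>) (lip_class M \<gamma>) = lip_class M (\<alpha> +++ \<gamma>)"
proof -
  have "lip_class M (\<alpha>' +++ \<gamma>') = lip_class M (\<alpha> +++ \<gamma>)"
    if "\<alpha>' \<in> lip_class M \<alpha>" "\<gamma>' \<in> lip_class M \<gamma>" for \<alpha>' \<gamma>'
    using that assms(3)
    by (intro lip_class_eqI[symmetric] lip_homotopic_join) (auto simp: lip_class_def)
  then show ?thesis
    using lip_class_self assms(1,2) unfolding class_concat_def by blast
qed

lemma lifted_dist_lip_class:
  assumes "lip_path M \<gamma>" "lip_path M \<delta>" "pathstart \<gamma> = pathstart \<delta>"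
  shows "lifted_dist M (lip_class M \<gamma>) (lip_class M \<delta>) =
    Inf {curve_length \<beta> | \<beta>. lip_homotopic M \<beta> (reversepath \<gamma> +++ \<delta>)}"
proof -
  have "(\<exists>\<gamma>'\<in>lip_class M \<gamma>. \<exists>\<delta>'\<in>lip_class M \<delta>. lip_homotopic M \<beta> (reversepath \<gamma>' +++ \<delta>')) \<longleftrightarrow>
    lip_homotopic M \<beta> (reversepath \<gamma> +++ \<delta>)" (is "?L \<longleftrightarrow> ?R") for \<beta>
  proof
    assume ?L
    then obtain \<gamma>' \<delta>' where *: "lip_homotopic M \<gamma> \<gamma>'" "lip_homotopic M \<delta> \<delta>'"
      "lip_homotopic M \<beta> (reversepath \<gamma>' +++ \<delta>')"
      by (auto simp: lip_class_def)
    have "lip_homotopic M (reversepath \<gamma> +++ \<delta>) (reversepath \<gamma>' +++ \<delta>')"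
      using * assms(3) by (intro lip_homotopic_join lip_homotopic_reversepath) auto
    then show ?R using *(3) lip_homotopic_trans lip_homotopic_sym by blast
  next
    assume ?R
    then show ?L using lip_class_self assms(1,2) by blast
  qed
  then show ?thesis unfolding lifted_dist_def by simp
qed

lemma lifted_dist_concat:
  assumes "lip_path M \<alpha>" "lip_path M \<gamma>" "lip_path M \<delta>"
    and "pathfinish \<alpha> = pathstart \<gamma>" "pathfinish \<alpha> = pathstart \<delta>"
  shows "lifted_dist M (lip_class M (\<alpha> +++ \<gamma>)) (lip_class M (\<alpha> +++ \<delta>)) =
    lifted_dist M (lip_class M \<gamma>) (lip_class M \<delta>)"
proof -
  have "lip_homotopic M ((reversepath \<gamma> +++ reversepath \<alpha>) +++ (\<alpha> +++ \<delta>))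
      (reversepath \<gamma> +++ (reversepath \<alpha> +++ (\<alpha> +++ \<delta>)))"
    using assms by (intro lip_homotopic_assoc lip_path_reversepath lip_path_join) auto
  also have "lip_homotopic M \<dots> (reversepath \<gamma> +++ \<delta>)"
    using assms
    by (intro lip_homotopic_join lip_homotopic_cancel_left lip_homotopic_refl lip_path_reversepath)
      auto
  finally have *: "lip_homotopic M (reversepath (\<alpha> +++ \<gamma>) +++ (\<alpha> +++ \<delta>)) (reversepath \<gamma> +++ \<delta>)"
    using assms(4) by (simp add: reversepath_joinpaths)
  have "lip_homotopic M \<beta> (reversepath (\<alpha> +++ \<gamma>) +++ (\<alpha> +++ \<delta>)) \<longleftrightarrow>
      lip_homotopic M \<beta> (reversepath \<gamma> +++ \<delta>)" for \<beta>
    using lip_homotopic_trans[OF _ *] lip_homotopic_trans[OF _ lip_homotopic_sym[OF *]] by blast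
  then show ?thesis
    using assms by (simp add: lifted_dist_lip_class lip_path_join)
qed

section \<open>The fundamental group and its action\<close>

lemma lip_pi1_carrierE:
  assumes "A \<in> carrier (lip_pi1 M p0)"
  obtains \<alpha> where "A = lip_class M \<alpha>" "lip_path M \<alpha>" "pathstart \<alpha> = p0" "pathfinish \<alpha> = p0"
  using assms by (auto simp: lip_pi1_def)

lemma lip_pi1_carrierI:
  "lip_path M \<alpha> \<Longrightarrow> pathstart \<alpha> = p0 \<Longrightarrow> pathfinish \<alpha> = p0 \<Longrightarrow>
    lip_class M \<alpha> \<in> carrier (lip_pi1 M p0)"
  by (auto simp: lip_pi1_def)

lemma lip_path_spaceE:
  assumes "X \<in> lip_path_space M p0"
  obtains \<gamma> where "X = lip_class M \<gamma>" "lip_path M \<gamma>" "pathstart \<gamma> = p0"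
  using assms by (auto simp: lip_path_space_def)

lemma lip_path_spaceI:
  "lip_path M \<gamma> \<Longrightarrow> pathstart \<gamma> = p0 \<Longrightarrow> lip_class M \<gamma> \<in> lip_path_space M p0"
  by (auto simp: lip_path_space_def)

lemma lip_pi1_mult [simp]: "A \<otimes>\<^bsub>lip_pi1 M p0\<^esub> B = class_concat M A B"
  by (simp add: lip_pi1_def)

lemma lip_pi1_one [simp]: "\<one>\<^bsub>lip_pi1 M p0\<^esub> = lip_class M (\<lambda>_. p0)"
  by (simp add: lip_pi1_def)

lemma class_concat_in_path_space:
  assumes "A \<in> carrier (lip_pi1 M p0)" "X \<in> lip_path_space M p0"
  shows "class_concat M A X \<in> lip_path_space M p0"
  using assms
  by (auto elim!: lip_pi1_carrierE lip_path_spaceE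
      simp: class_concat_lip_class intro!: lip_path_spaceI lip_path_join)

lemma class_concat_assoc:
  assumes "A \<in> carrier (lip_pi1 M p0)" "B \<in> carrier (lip_pi1 M p0)" "X \<in> lip_path_space M p0"
  shows "class_concat M (class_concat M A B) X = class_concat M A (class_concat M B X)"
proof -
  obtain \<alpha> where \<alpha>: "A = lip_class M \<alpha>" "lip_path M \<alpha>" "pathfinish \<alpha> = p0"
    using assms(1) by (rule lip_pi1_carrierE)
  obtain \<beta> where \<beta>: "B = lip_class M \<beta>" "lip_path M \<beta>" "pathstart \<beta> = p0" "pathfinish \<beta> = p0"
    using assms(2) by (rule lip_pi1_carrierE)
  obtain \<gamma> where \<gamma>: "X = lip_class M \<gamma>" "lip_path M \<gamma>" "pathstart \<gamma> = p0"
    using assms(3) by (rule lip_path_spaceE)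
  have "lip_class M ((\<alpha> +++ \<beta>) +++ \<gamma>) = lip_class M (\<alpha> +++ (\<beta> +++ \<gamma>))"
    using \<alpha> \<beta> \<gamma> by (intro lip_class_eqI lip_homotopic_assoc) auto
  then show ?thesis
    using \<alpha> \<beta> \<gamma> by (simp add: class_concat_lip_class lip_path_join)
qed

lemma class_concat_one:
  assumes "X \<in> lip_path_space M p0"
  shows "class_concat M (lip_class M (\<lambda>_. p0)) X = X"
proof -
  obtain \<gamma> where X: "X = lip_class M \<gamma>" and \<gamma>: "lip_path M \<gamma>" "pathstart \<gamma> = p0"
    using assms by (rule lip_path_spaceE)
  have "lip_path M (\<lambda>_. p0)" using lip_path_pathstart[OF \<gamma>(1)] \<gamma>(2) by (simp add: lip_path_const)
  moreover have "pathfinish (\<lambda>_::real. p0) = pathstart \<gamma>" using \<gamma> by (simp add: pathfinish_def)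
  ultimately show ?thesis
    unfolding X using \<gamma>
    by (simp add: class_concat_lip_class lip_class_eqI[OF lip_homotopic_const_join])
qed

text \<open>
  Loops are paths starting at \<open>p0\<close>, so the associative and unit laws of the action contain those of
  the group.
\<close>

lemma lip_pi1_carrier_subset: "carrier (lip_pi1 M p0) \<subseteq> lip_path_space M p0"
  by (auto simp: lip_pi1_def lip_path_space_def)

lemma group_lip_pi1:
  assumes "p0 \<in> M"
  shows "group (lip_pi1 M p0)"
proof (rule groupI)
  fix A B assume "A \<in> carrier (lip_pi1 M p0)" "B \<in> carrier (lip_pi1 M p0)"
  then show "A \<otimes>\<^bsub>lip_pi1 M p0\<^esub> B \<in> carrier (lip_pi1 M p0)"
    by (auto elim!: lip_pi1_carrierE
        simp: class_concat_lip_class intro!: lip_pi1_carrierI lip_path_join)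
next
  show "\<one>\<^bsub>lip_pi1 M p0\<^esub> \<in> carrier (lip_pi1 M p0)"
    using lip_pi1_carrierI[OF lip_path_const[OF assms]]
    by (simp add: pathstart_def pathfinish_def)
next
  fix A assume "A \<in> carrier (lip_pi1 M p0)"
  then obtain \<alpha> where \<alpha>: "A = lip_class M \<alpha>" "lip_path M \<alpha>" "pathstart \<alpha> = p0" "pathfinish \<alpha> = p0"
    by (rule lip_pi1_carrierE)
  have "class_concat M (lip_class M (reversepath \<alpha>)) A = lip_class M (\<lambda>_. p0)"
    using \<alpha> by (simp add: class_concat_lip_class lip_path_reversepath
        lip_class_eqI[OF lip_homotopic_reversepath_join])
  moreover have "lip_class M (reversepath \<alpha>) \<in> carrier (lip_pi1 M p0)"
    using \<alpha> by (intro lip_pi1_carrierI lip_path_reversepath) auto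
  ultimately show "\<exists>B\<in>carrier (lip_pi1 M p0). B \<otimes>\<^bsub>lip_pi1 M p0\<^esub> A = \<one>\<^bsub>lip_pi1 M p0\<^esub>"
    by auto
next
  fix A B C assume "A \<in> carrier (lip_pi1 M p0)" "B \<in> carrier (lip_pi1 M p0)"
    "C \<in> carrier (lip_pi1 M p0)"
  then show "A \<otimes>\<^bsub>lip_pi1 M p0\<^esub> B \<otimes>\<^bsub>lip_pi1 M p0\<^esub> C =
      A \<otimes>\<^bsub>lip_pi1 M p0\<^esub> (B \<otimes>\<^bsub>lip_pi1 M p0\<^esub> C)"
    unfolding lip_pi1_mult by (intro class_concat_assoc subsetD[OF lip_pi1_carrier_subset])
next
  fix A assume "A \<in> carrier (lip_pi1 M p0)"
  then show "\<one>\<^bsub>lip_pi1 M p0\<^esub> \<otimes>\<^bsub>lip_pi1 M p0\<^esub> A = A"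
    unfolding lip_pi1_mult lip_pi1_one
    by (intro class_concat_one subsetD[OF lip_pi1_carrier_subset])
qed

text \<open>
  The familiar axioms of a left action; each permutation is bijective because the inverse group
  element undoes it.
\<close>

lemma (in group) group_action_restrictI:
  assumes closed: "\<And>g x. g \<in> carrier G \<Longrightarrow> x \<in> E \<Longrightarrow> act g x \<in> E"
    and one: "\<And>x. x \<in> E \<Longrightarrow> act \<one> x = x"
    and mult: "\<And>g h x. g \<in> carrier G \<Longrightarrow> h \<in> carrier G \<Longrightarrow> x \<in> E \<Longrightarrow>
      act (g \<otimes> h) x = act g (act h x)"
  shows "group_action G E (\<lambda>g. \<lambda>x\<in>E. act g x)"
proof -
  have bij: "(\<lambda>x\<in>E. act g x) \<in> Bij E" if g: "g \<in> carrier G" for g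
  proof -
    have "act (inv g) (act g x) = x" "act g (act (inv g) x) = x" if "x \<in> E" for x
      using that g one by (simp_all flip: mult)
    then have "bij_betw (act g) E E"
      using g closed by (intro bij_betwI[where g = "act (inv g)"]) auto
    then show ?thesis by (simp add: Bij_def)
  qed
  have "(\<lambda>g. \<lambda>x\<in>E. act g x) \<in> hom G (BijGroup E)"
    using bij closed mult by (auto simp: hom_def BijGroup_def compose_def fun_eq_iff)
  then show ?thesis
    unfolding group_action_def group_hom_def group_hom_axioms_def
    using group_BijGroup is_group by blast
qed

theorem theorem2p11:
  fixes M :: "'a::metric_space set" and p0 :: 'a
  assumes "p0 \<in> M"
    and "lip_path_connected M"
    and "\<exists>x\<in>M. \<exists>y\<in>M. x \<noteq> y"
  shows "group_action (lip_pi1 M p0) (lip_path_space M p0) (concat_action M p0)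
    \<and> (\<forall>\<alpha> \<gamma>. lip_path M \<alpha> \<and> pathstart \<alpha> = p0 \<and> pathfinish \<alpha> = p0 \<and>
              lip_path M \<gamma> \<and> pathstart \<gamma> = p0 \<longrightarrow>
         concat_action M p0 (lip_class M \<alpha>) (lip_class M \<gamma>) = lip_class M (\<alpha> +++ \<gamma>))
    \<and> (\<forall>X \<in> lip_path_space M p0.
         stabilizer (lip_pi1 M p0) (concat_action M p0) X = {\<one>\<^bsub>lip_pi1 M p0\<^esub>})
    \<and> (\<forall>A \<in> carrier (lip_pi1 M p0). \<forall>X \<in> lip_path_space M p0. \<forall>Y \<in> lip_path_space M p0.
         lifted_dist M (concat_action M p0 A X) (concat_action M p0 A Y) = lifted_dist M X Y)"
proof (intro conjI ballI allI impI)
  interpret group "lip_pi1 M p0" using assms(1) by (rule group_lip_pi1)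
  have "group_action (lip_pi1 M p0) (lip_path_space M p0)
      (\<lambda>A. \<lambda>X\<in>lip_path_space M p0. class_concat M A X)"
    by (rule group_action_restrictI)
      (simp_all add: class_concat_in_path_space class_concat_one class_concat_assoc)
  then show "group_action (lip_pi1 M p0) (lip_path_space M p0) (concat_action M p0)"
    unfolding concat_action_def .
next
  fix \<alpha> \<gamma>
  assume "lip_path M \<alpha> \<and> pathstart \<alpha> = p0 \<and> pathfinish \<alpha> = p0 \<and> lip_path M \<gamma> \<and> pathstart \<gamma> = p0"
  then show "concat_action M p0 (lip_class M \<alpha>) (lip_class M \<gamma>) = lip_class M (\<alpha> +++ \<gamma>)"
    by (simp add: concat_action_def lip_path_spaceI class_concat_lip_class)
next
  fix X assume X: "X \<in> lip_path_space M p0"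
  then obtain \<gamma> where \<gamma>: "X = lip_class M \<gamma>" "lip_path M \<gamma>" "pathstart \<gamma> = p0"
    by (rule lip_path_spaceE)
  have "A = lip_class M (\<lambda>_. p0)"
    if A: "A \<in> carrier (lip_pi1 M p0)" and fixed: "class_concat M A X = X" for A
  proof -
    obtain \<alpha> where \<alpha>: "A = lip_class M \<alpha>" "lip_path M \<alpha>" "pathstart \<alpha> = p0" "pathfinish \<alpha> = p0"
      using A by (rule lip_pi1_carrierE)
    \<comment> \<open>cancel \<open>\<gamma>\<close> from \<open>\<alpha> +++ \<gamma> \<simeq> \<gamma>\<close> on the right\<close>
    have "lip_homotopic M (\<alpha> +++ \<gamma>) \<gamma>"
      using fixed \<alpha> \<gamma> by (simp add: class_concat_lip_class lip_class_eq_iff)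
    then have "lip_homotopic M ((\<alpha> +++ \<gamma>) +++ reversepath \<gamma>) (\<gamma> +++ reversepath \<gamma>)"
      using \<gamma> by (intro lip_homotopic_join lip_homotopic_refl lip_path_reversepath) auto
    moreover have "lip_homotopic M \<alpha> ((\<alpha> +++ \<gamma>) +++ reversepath \<gamma>)"
      using \<alpha> \<gamma> by (intro lip_homotopic_sym[OF lip_homotopic_cancel_right]) auto
    ultimately have "lip_homotopic M \<alpha> (\<lambda>_. p0)"
      using lip_homotopic_join_reversepath[OF \<gamma>(2,3)] lip_homotopic_trans by blast
    then show ?thesis using \<alpha>(1) lip_class_eqI by blast
  qed
  moreover have "lip_class M (\<lambda>_. p0) \<in> carrier (lip_pi1 M p0)"
    using group.is_monoid[OF group_lip_pi1[OF assms(1)]] monoid.one_closed by fastforce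
  ultimately have "{A \<in> carrier (lip_pi1 M p0). class_concat M A X = X} = {lip_class M (\<lambda>_. p0)}"
    using class_concat_one[OF X] by blast
  then show "stabilizer (lip_pi1 M p0) (concat_action M p0) X = {\<one>\<^bsub>lip_pi1 M p0\<^esub>}"
    unfolding stabilizer_def concat_action_def lip_pi1_one restrict_apply'[OF X] .
next
  fix A X Y
  assume A: "A \<in> carrier (lip_pi1 M p0)"
    and X: "X \<in> lip_path_space M p0" and Y: "Y \<in> lip_path_space M p0"
  obtain \<alpha> where \<alpha>: "A = lip_class M \<alpha>" "lip_path M \<alpha>" "pathfinish \<alpha> = p0"
    using A by (rule lip_pi1_carrierE)
  obtain \<gamma> where \<gamma>: "X = lip_class M \<gamma>" "lip_path M \<gamma>" "pathstart \<gamma> = p0"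
    using X by (rule lip_path_spaceE)
  obtain \<delta> where \<delta>: "Y = lip_class M \<delta>" "lip_path M \<delta>" "pathstart \<delta> = p0"
    using Y by (rule lip_path_spaceE)
  show "lifted_dist M (concat_action M p0 A X) (concat_action M p0 A Y) = lifted_dist M X Y"
    using X Y \<alpha> \<gamma> \<delta> by (simp add: concat_action_def class_concat_lip_class lifted_dist_concat)
qed

end
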